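(* Let $q=2^k$ with $k\ge 1$, let $b,c\in\mathbb{F}_q$ and $d\in\mathbb{F}_{q^2}$. If either ($b=0$ and $c=1$) or ($b\neq 0$ and $c\neq 1$), then $x^q+bx^2+cx+d\in\mathbb{F}_{q^2}[x]$ is not a permutation polynomial of $\mathbb{F}_{q^2}$.
   Context: $\mathbb{F}_q\subset\mathbb{F}_{q^2}$ are the finite fields with $q$ and $q^2$ elements. A polynomial over $\mathbb{F}_{q^2}$ is a permutation polynomial of $\mathbb{F}_{q^2}$ if it induces a bijection of $\mathbb{F}_{q^2}$ onto itself. *)

theory Defs
  imports "HOL-Algebra.UnivPoly" "HOL-Algebra.Subrings"
begin

definition permutation_polynomial ::
    "('a, 'm) ring_scheme \<Rightarrow> (nat \<Rightarrow> 'a) \<Rightarrow> bool" where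
  "permutation_polynomial R p \<longleftrightarrow>
     bij_betw (\<lambda>x. eval R R id x p) (carrier R) (carrier R)"

end

theory Submission
  imports Defs "HOL-Algebra.Multiplicative_Group"
begin

text \<open>
  Up to the constant \<open>d\<close>, the polynomial induces an additive map, so it suffices to find a
  nonzero root of \<open>x ^ q + b x\<^sup>2 + c x\<close>. On the subfield \<open>F\<close> the Frobenius power
  \<open>x ^ q\<close> collapses to \<open>x\<close> (lemma \<open>subfield_pow_card\<close>), and the map becomes
  \<open>x (1 + c + b x)\<close>. The two alternatives of the hypothesis are cases in which the linear factor
  has a nonzero root in \<open>F\<close>: if \<open>b = 0\<close> and \<open>c = 1\<close> it vanishes identically, because
  the characteristic is 2, and if \<open>b \<noteq> 0\<close> and \<open>c \<noteq> 1\<close> its root is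
  \<open>(1 + c) / b\<close>. That root and \<open>0\<close> are then two points with the same value \<open>d\<close>.
\<close>

text \<open>
  The nonzero elements of \<open>F\<close> form a group of order \<open>card F - 1\<close>, so this is
  Lagrange's theorem multiplied by one more factor \<open>x\<close>.
\<close>
lemma (in field) subfield_pow_card:
  assumes F: "subfield F R" "finite F" and x: "x \<in> F"
  shows "x [^] card F = x"
proof -
  let ?F = "R\<lparr>carrier := F\<rparr>"
  interpret F: field ?F
    using F subfield_iff(2) by blast
  have xR: "x \<in> carrier R"
    using subfieldE(3)[OF F(1)] x by blast
  have card: "card F = Suc (order (mult_of ?F))"
    using F(2) F.order_mult_of F.order_gt_0_iff_finite by (simp add: Coset.order_def)
  show ?thesis
  proof (cases "x = \<zero>")
    case True
    then show ?thesis using card by simp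
  next
    case False
    have "x [^]\<^bsub>mult_of ?F\<^esub> order (mult_of ?F) = \<one>"
      using group.pow_order_eq_1[OF F.field_mult_group] x False by simp
    then have "x [^] order (mult_of ?F) = \<one>"
      by (simp add: nat_pow_mult_of nat_pow_consistent[symmetric])
    then show ?thesis using card xR by simp
  qed
qed

text \<open>
  With an even exponent, \<open>(- 1) ^ card F = 1\<close>, while \<open>- 1\<close> is fixed by the
  \<open>card F\<close>-th power; hence \<open>- 1 = 1\<close>.
\<close>
lemma (in field) subfield_even_card_add_self:
  assumes F: "subfield F R" "finite F" "even (card F)" and x: "x \<in> carrier R"
  shows "x \<oplus> x = \<zero>"
proof -
  have sub: "subring F R" using F(1) by (simp add: subfieldE(1))
  have "\<ominus> \<one> \<in> F"
    using subringE(3,5)[OF sub] by simp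
  then have "(\<ominus> \<one>) [^] card F = \<ominus> \<one>"
    using F subfield_pow_card by blast
  moreover have "(\<ominus> \<one>) [^] card F = \<one>"
  proof -
    obtain m where m: "card F = 2 * m" using F(3) by (elim evenE)
    have "(\<ominus> \<one>) [^] (2::nat) = \<one>"
      by (simp add: numeral_2_eq_2 l_minus r_minus)
    then show ?thesis
      using m nat_pow_pow[of "\<ominus> \<one>" 2 m] by simp
  qed
  ultimately have "\<ominus> \<one> = \<one>" by simp
  then have "\<one> \<oplus> \<one> = \<zero>"
    by (metis one_closed r_neg)
  then have "x \<otimes> (\<one> \<oplus> \<one>) = \<zero>"
    using x by simp
  then show ?thesis using x by (simp add: r_distr)
qed

lemma (in cring) eval_four_monoms:
  fixes n\<^sub>1 n\<^sub>2 n\<^sub>3 n\<^sub>4 :: nat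
  assumes "a\<^sub>1 \<in> carrier R" "a\<^sub>2 \<in> carrier R" "a\<^sub>3 \<in> carrier R" "a\<^sub>4 \<in> carrier R" "x \<in> carrier R"
  shows "eval R R id x
      (monom (UP R) a\<^sub>1 n\<^sub>1 \<oplus>\<^bsub>UP R\<^esub> monom (UP R) a\<^sub>2 n\<^sub>2 \<oplus>\<^bsub>UP R\<^esub>
       monom (UP R) a\<^sub>3 n\<^sub>3 \<oplus>\<^bsub>UP R\<^esub> monom (UP R) a\<^sub>4 n\<^sub>4) =
    a\<^sub>1 \<otimes> x [^] n\<^sub>1 \<oplus> a\<^sub>2 \<otimes> x [^] n\<^sub>2 \<oplus> a\<^sub>3 \<otimes> x [^] n\<^sub>3 \<oplus> a\<^sub>4 \<otimes> x [^] n\<^sub>4"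
proof -
  interpret UP_pre_univ_prop R R id "UP R"
    by (auto intro!: UP_pre_univ_propI is_cring)
  have hom: "eval R R id x \<in> ring_hom (UP R) R"
    using eval_ring_hom assms by blast
  show ?thesis
    using assms by (simp add: ring_hom_add[OF hom] eval_monom del: id_apply) simp
qed

theorem theorem3p7:
  fixes K :: "('a, 'm) ring_scheme" and F :: "'a set"
    and k q :: nat and b c d :: 'a
  assumes "field K" and "subfield F K"
    and "k \<ge> 1" and "q = 2 ^ k"
    and "order K = q ^ 2" and "card F = q"
    and "b \<in> F" and "c \<in> F" and "d \<in> carrier K"
    and "(b = \<zero>\<^bsub>K\<^esub> \<and> c = \<one>\<^bsub>K\<^esub>) \<or> (b \<noteq> \<zero>\<^bsub>K\<^esub> \<and> c \<noteq> \<one>\<^bsub>K\<^esub>)"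
  shows "\<not> permutation_polynomial K
    (monom (UP K) \<one>\<^bsub>K\<^esub> q \<oplus>\<^bsub>UP K\<^esub> monom (UP K) b 2 \<oplus>\<^bsub>UP K\<^esub>
     monom (UP K) c 1 \<oplus>\<^bsub>UP K\<^esub> monom (UP K) d 0)"
proof -
  interpret K: field K by fact
  let ?p = "monom (UP K) \<one>\<^bsub>K\<^esub> q \<oplus>\<^bsub>UP K\<^esub> monom (UP K) b 2 \<oplus>\<^bsub>UP K\<^esub>
     monom (UP K) c 1 \<oplus>\<^bsub>UP K\<^esub> monom (UP K) d 0"
  have FK: "F \<subseteq> carrier K" and sub: "subring F K"
    using assms(2) by (simp_all add: subfieldE)
  then have bK: "b \<in> carrier K" and cK: "c \<in> carrier K"
    using assms by auto
  have "q > 0" "even q" using assms by simp_all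
  then have fin: "finite F" and ev: "even (card F)"
    using assms(6) by (auto intro: card_ge_0_finite)
  note char2 = K.subfield_even_card_add_self[OF assms(2) fin ev]
  have "\<exists>x\<in>F. x \<noteq> \<zero>\<^bsub>K\<^esub> \<and> \<one>\<^bsub>K\<^esub> \<oplus>\<^bsub>K\<^esub> c \<oplus>\<^bsub>K\<^esub> b \<otimes>\<^bsub>K\<^esub> x = \<zero>\<^bsub>K\<^esub>"
    using assms(10)
  proof
    assume "b = \<zero>\<^bsub>K\<^esub> \<and> c = \<one>\<^bsub>K\<^esub>"
    then show ?thesis
      using subringE(3)[OF sub] char2[of "\<one>\<^bsub>K\<^esub>"] by (intro bexI[of _ "\<one>\<^bsub>K\<^esub>"]) auto
  next
    assume bc: "b \<noteq> \<zero>\<^bsub>K\<^esub> \<and> c \<noteq> \<one>\<^bsub>K\<^esub>"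
    define u where "u = \<one>\<^bsub>K\<^esub> \<oplus>\<^bsub>K\<^esub> c"
    define x where "x = inv\<^bsub>K\<^esub> b \<otimes>\<^bsub>K\<^esub> u"
    have uF: "u \<in> F"
      unfolding u_def using sub assms by (simp add: subringE)
    then have uK: "u \<in> carrier K" using FK by blast
    have "u \<noteq> \<zero>\<^bsub>K\<^esub>"
    proof
      assume "u = \<zero>\<^bsub>K\<^esub>"
      then have "\<one>\<^bsub>K\<^esub> \<oplus>\<^bsub>K\<^esub> c = \<one>\<^bsub>K\<^esub> \<oplus>\<^bsub>K\<^esub> \<one>\<^bsub>K\<^esub>"
        using char2[of "\<one>\<^bsub>K\<^esub>"] u_def by simp
      then show False using bc cK by simp
    qed
    have invF: "inv\<^bsub>K\<^esub> b \<in> F"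
      using K.subfield_m_inv(1)[OF assms(2)] bc assms(7) by blast
    have xF: "x \<in> F"
      unfolding x_def using sub uF invF by (simp add: subringE)
    then have xK: "x \<in> carrier K" using FK by blast
    have bx: "b \<otimes>\<^bsub>K\<^esub> x = u"
      using bK bc uK K.field_Units invF FK
      by (auto simp: x_def K.m_assoc[symmetric])
    have "x \<noteq> \<zero>\<^bsub>K\<^esub>"
      using bx \<open>u \<noteq> \<zero>\<^bsub>K\<^esub>\<close> bK by auto
    then show ?thesis
      using xF bx char2[OF uK] by (auto simp: u_def)
  qed
  then obtain x where xF: "x \<in> F" and x0: "x \<noteq> \<zero>\<^bsub>K\<^esub>"
    and root: "\<one>\<^bsub>K\<^esub> \<oplus>\<^bsub>K\<^esub> c \<oplus>\<^bsub>K\<^esub> b \<otimes>\<^bsub>K\<^esub> x = \<zero>\<^bsub>K\<^esub>" by blast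
  have xK: "x \<in> carrier K" using xF FK by blast
  have xq: "x [^]\<^bsub>K\<^esub> q = x"
    using K.subfield_pow_card[OF assms(2) fin xF] assms(6) by simp
  have "x \<oplus>\<^bsub>K\<^esub> b \<otimes>\<^bsub>K\<^esub> (x \<otimes>\<^bsub>K\<^esub> x) \<oplus>\<^bsub>K\<^esub> c \<otimes>\<^bsub>K\<^esub> x
      = (\<one>\<^bsub>K\<^esub> \<oplus>\<^bsub>K\<^esub> c \<oplus>\<^bsub>K\<^esub> b \<otimes>\<^bsub>K\<^esub> x) \<otimes>\<^bsub>K\<^esub> x"
    using xK bK cK by algebra
  also have "\<dots> = \<zero>\<^bsub>K\<^esub>" using root xK by simp
  finally have "eval K K id x ?p = d"
    using K.eval_four_monoms[of "\<one>\<^bsub>K\<^esub>" b c d x q 2 1 0] xK bK cK assms(9)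
    by (simp add: xq numeral_2_eq_2)
  moreover have "eval K K id \<zero>\<^bsub>K\<^esub> ?p = d"
    using K.eval_four_monoms[of "\<one>\<^bsub>K\<^esub>" b c d "\<zero>\<^bsub>K\<^esub>" q 2 1 0] bK cK assms(9) \<open>q > 0\<close>
    by (simp add: K.nat_pow_zero)
  ultimately have "\<not> inj_on (\<lambda>y. eval K K id y ?p) (carrier K)"
    using xK x0 by (metis (no_types, lifting) K.zero_closed inj_onD)
  then show ?thesis
    unfolding permutation_polynomial_def bij_betw_def by blast
qed

end
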